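(* Let $G$ be a finite group of odd order and let $A$ be a graph subset of $G$ with associated digraph $\Gamma[A]$ on $G$. Let $G^*$ denote the group of automorphisms of the group $G$. (a) If $\xi \in G^*$, then $\xi(A)$ is a graph subset and $\xi$ is an isomorphism from $\Gamma[A]$ to $\Gamma[\xi(A)]$. (b) The group $Aut(\Gamma[A])$ is commutative if and only if $G$ is commutative and $Aut(\Gamma[A]) = G$, i.e. the left translations are the only automorphisms of $\Gamma[A]$. (c) Assume that $Aut(\Gamma[A]) = G$. If $B$ is a graph subset of $G$ with $\Gamma[B]$ isomorphic to $\Gamma[A]$, then there is a unique $\xi \in G^*$ such that $B = \xi(A)$, and $\rho = \xi$ is the unique isomorphism $\rho : \Gamma[A] \to \Gamma[B]$ such that $\rho(e) = e$. In particular, the set $\{\xi(A) : \xi \in G^*\}$ is the set of graph subsets $B$ such that $\Gamma[B]$ is isomorphic to $\Gamma[A]$. Thus, there are exactly $|G^*|$ such graph subsets. (d) If $A \subset \mathbb{Z}_{2n+1}$ is a graph subset such that $Aut(\Gamma[A]) = \mathbb{Z}_{2n+1}$, then the set $\{m_a(A) : a \in \mathbb{Z}_{2n+1}^*\}$ is the set of graph subsets $B$ such that $\Gamma[B]$ is isomorphic to $\Gamma[A]$. Thus, there are exactly $\phi(2n+1)$ such subsets.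
   Context: A graph subset of a group $G$ (with identity $e$) is a nonempty subset $A \subset G$ with $A \cap A^{-1} = \emptyset$, where $A^{-1} = \{a^{-1} : a \in A\}$. The associated digraph is $\Gamma[A] = \{(i,j) \in G \times G : i^{-1}j \in A\}$. An isomorphism from a digraph $\Pi$ on $I$ to a digraph $\Gamma$ on $J$ is a bijection $\rho : I \to J$ with $(i,j)\in\Pi \Leftrightarrow (\rho(i),\rho(j)) \in \Gamma$; $Aut(\Pi)$ is the group of isomorphisms from $\Pi$ to itself. Each left translation $\ell_k(i) = ki$ is an automorphism of $\Gamma[A]$; identifying $k$ with $\ell_k$, $G$ is regarded as a subgroup of $Aut(\Gamma[A])$. $\mathbb{Z}_{2n+1}$ is the additive group of integers mod $2n+1$, $\mathbb{Z}_{2n+1}^*$ is the group of units of the ring $\mathbb{Z}_{2n+1}$, $m_a(i) = ai$, and $\phi$ is the Euler function. *)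

theory Defs
  imports "HOL-Algebra.Bij" "HOL-Number_Theory.Residues" "HOL-Number_Theory.Totient"
begin

definition graph_subset :: "('a, 'b) monoid_scheme \<Rightarrow> 'a set \<Rightarrow> bool" where
  "graph_subset G A \<longleftrightarrow> A \<subseteq> carrier G \<and> A \<noteq> {} \<and> A \<inter> m_inv G ` A = {}"

definition assoc_digraph :: "('a, 'b) monoid_scheme \<Rightarrow> 'a set \<Rightarrow> 'a rel" where
  "assoc_digraph G A =
     {(i, j). i \<in> carrier G \<and> j \<in> carrier G \<and> inv\<^bsub>G\<^esub> i \<otimes>\<^bsub>G\<^esub> j \<in> A}"

text \<open>
  A digraph is a relation together with its vertex set, which is passed separately.  As for
  \<^const>\<open>Bij\<close> and \<^const>\<open>auto\<close>, maps are required to be extensional, i.e. \<^const>\<open>undefined\<close> off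
  the vertex set, so that uniqueness and cardinality statements are meaningful.
\<close>

definition digraph_isos :: "'i set \<Rightarrow> 'i rel \<Rightarrow> 'j set \<Rightarrow> 'j rel \<Rightarrow> ('i \<Rightarrow> 'j) set" where
  "digraph_isos I P J \<Gamma> =
     {\<rho> \<in> extensional I. bij_betw \<rho> I J \<and>
        (\<forall>i\<in>I. \<forall>j\<in>I. (i, j) \<in> P \<longleftrightarrow> (\<rho> i, \<rho> j) \<in> \<Gamma>)}"

definition digraph_isomorphic :: "'i set \<Rightarrow> 'i rel \<Rightarrow> 'j set \<Rightarrow> 'j rel \<Rightarrow> bool" where
  "digraph_isomorphic I P J \<Gamma> \<longleftrightarrow> digraph_isos I P J \<Gamma> \<noteq> {}"

definition digraph_Aut :: "'i set \<Rightarrow> 'i rel \<Rightarrow> ('i \<Rightarrow> 'i) monoid" where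
  "digraph_Aut I P = BijGroup I \<lparr>carrier := digraph_isos I P I P\<rparr>"

text \<open>The copy of \<open>G\<close> inside the automorphism group of \<^term>\<open>assoc_digraph G A\<close>.\<close>

definition left_translations :: "('a, 'b) monoid_scheme \<Rightarrow> ('a \<Rightarrow> 'a) set" where
  "left_translations G = (\<lambda>k. \<lambda>i\<in>carrier G. k \<otimes>\<^bsub>G\<^esub> i) ` carrier G"

end

theory Submission
  imports Defs
begin

text \<open>
  Everything rests on one rigidity fact: if the automorphisms of \<open>\<Gamma>[A]\<close> are just the left
  translations, then two isomorphisms \<open>\<rho>, \<sigma>\<close> from \<open>\<Gamma>[A]\<close> to any digraph agree as soon as they
  agree at the identity, because \<open>\<sigma>\<^sup>-\<^sup>1 \<rho>\<close> is a left translation fixing the identity.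
  Applied to \<open>\<rho>\<close> and to \<open>\<rho>\<close> sandwiched between translations by \<open>k\<close> and \<open>(\<rho> k)\<^sup>-\<^sup>1\<close>, it shows
  that an isomorphism onto some \<open>\<Gamma>[B]\<close> that fixes the identity is a group automorphism.
\<close>

section \<open>Digraph isomorphisms\<close>

lemma digraph_isosD:
  assumes "f \<in> digraph_isos I P J Q"
  shows "f \<in> extensional I" "bij_betw f I J"
    and "\<And>i j. i \<in> I \<Longrightarrow> j \<in> I \<Longrightarrow> (f i, f j) \<in> Q \<longleftrightarrow> (i, j) \<in> P"
  using assms by (auto simp: digraph_isos_def)

lemma digraph_isos_mem:
  assumes "f \<in> digraph_isos I P J Q" "i \<in> I"
  shows "f i \<in> J"
  using digraph_isosD(2)[OF assms(1)] assms(2) by (rule bij_betw_apply)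

lemma digraph_isos_compose:
  assumes f: "f \<in> digraph_isos I P J Q" and g: "g \<in> digraph_isos J Q K R"
  shows "compose I g f \<in> digraph_isos I P K R"
proof -
  have "bij_betw (compose I g f) I K"
    using digraph_isosD(2)[OF f] digraph_isosD(2)[OF g] by (rule bij_betw_compose)
  then show ?thesis
    using digraph_isosD(3)[OF f] digraph_isosD(3)[OF g] digraph_isos_mem[OF f]
    by (simp add: digraph_isos_def compose_eq)
qed

text \<open>The inverse is restricted to \<open>J\<close> because digraph isomorphisms have to be
  extensional on their domain.\<close>

lemma digraph_isos_inv_into:
  assumes f: "f \<in> digraph_isos I P J Q"
  shows "(\<lambda>j\<in>J. inv_into I f j) \<in> digraph_isos J Q I P"
proof -
  note bij = digraph_isosD(2)[OF f]
  have "bij_betw (\<lambda>j\<in>J. inv_into I f j) J I"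
    using bij_betw_inv_into[OF bij] by simp
  moreover have "(i, j) \<in> Q \<longleftrightarrow> (inv_into I f i, inv_into I f j) \<in> P" if "i \<in> J" "j \<in> J" for i j
  proof -
    have "inv_into I f i \<in> I" "inv_into I f j \<in> I"
      using that bij_betw_inv_into[OF bij] by (auto dest: bij_betw_apply)
    from digraph_isosD(3)[OF f this] show ?thesis
      using that bij by (simp add: bij_betw_inv_into_right)
  qed
  ultimately show ?thesis
    by (simp add: digraph_isos_def)
qed

lemma digraph_isomorphic_sym:
  "digraph_isomorphic I P J Q \<Longrightarrow> digraph_isomorphic J Q I P"
  unfolding digraph_isomorphic_def by (metis digraph_isos_inv_into ex_in_conv)

lemma digraph_isos_self_subset_Bij: "digraph_isos I P I P \<subseteq> Bij I"
  by (auto simp: digraph_isos_def Bij_def)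

lemma carrier_digraph_Aut [simp]: "carrier (digraph_Aut I P) = digraph_isos I P I P"
  by (simp add: digraph_Aut_def)

lemma mult_digraph_Aut:
  assumes "f \<in> digraph_isos I P I P" "g \<in> digraph_isos I P I P"
  shows "f \<otimes>\<^bsub>digraph_Aut I P\<^esub> g = compose I f g"
  using assms digraph_isos_self_subset_Bij[of I P] by (auto simp: digraph_Aut_def BijGroup_def)

text \<open>\<open>digraph_Aut\<close> keeps the operation of \<open>BijGroup I\<close> and only
  shrinks the carrier, so closure under composition and inverses is what matters.\<close>

lemma group_digraph_Aut: "group (digraph_Aut I P)"
proof -
  have "subgroup (digraph_isos I P I P) (BijGroup I)"
  proof (rule subgroup.intro)
    show "digraph_isos I P I P \<subseteq> carrier (BijGroup I)"
      using digraph_isos_self_subset_Bij by (simp add: BijGroup_def)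
    show "\<one>\<^bsub>BijGroup I\<^esub> \<in> digraph_isos I P I P"
      by (auto simp: BijGroup_def digraph_isos_def bij_betw_def inj_on_def)
    show "f \<otimes>\<^bsub>BijGroup I\<^esub> g \<in> digraph_isos I P I P"
      if "f \<in> digraph_isos I P I P" "g \<in> digraph_isos I P I P" for f g
      using mult_digraph_Aut[OF that] digraph_isos_compose[OF that(2,1)]
      by (simp add: digraph_Aut_def)
    show "inv\<^bsub>BijGroup I\<^esub> f \<in> digraph_isos I P I P" if "f \<in> digraph_isos I P I P" for f
      using that digraph_isos_self_subset_Bij[of I P] digraph_isos_inv_into[OF that]
      by (simp add: inv_BijGroup subsetD del: restrict_apply)
  qed
  then show ?thesis
    unfolding digraph_Aut_def by (rule subgroup.subgroup_is_group[OF _ group_BijGroup])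
qed

section \<open>Digraphs of graph subsets\<close>

lemma autoD:
  assumes "\<xi> \<in> auto G"
  shows "\<xi> \<in> extensional (carrier G)" "bij_betw \<xi> (carrier G) (carrier G)" "\<xi> \<in> hom G G"
  using assms by (auto simp: auto_def Bij_def)

context group
begin

lemma mem_assoc_digraph_one:
  "A \<subseteq> carrier G \<Longrightarrow> x \<in> carrier G \<Longrightarrow> (\<one>, x) \<in> assoc_digraph G A \<longleftrightarrow> x \<in> A"
  by (simp add: assoc_digraph_def)

text \<open>The factor \<open>k\<close> cancels in (k i)^-1 (k j), so the arc condition is
  untouched, whatever the set \<open>A\<close> is.\<close>

lemma left_translation_iso:
  assumes k: "k \<in> carrier G"
  shows "(\<lambda>i\<in>carrier G. k \<otimes> i)
    \<in> digraph_isos (carrier G) (assoc_digraph G A) (carrier G) (assoc_digraph G A)"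
proof -
  have "bij_betw (\<lambda>i. k \<otimes> i) (carrier G) (carrier G)"
    by (rule bij_betw_byWitness[where f' = "\<lambda>i. inv k \<otimes> i"])
      (use k in \<open>auto simp: m_assoc[symmetric]\<close>)
  moreover have "inv (k \<otimes> i) \<otimes> (k \<otimes> j) = inv i \<otimes> j" if "i \<in> carrier G" "j \<in> carrier G" for i j
  proof -
    have "inv (k \<otimes> i) \<otimes> (k \<otimes> j) = inv i \<otimes> (inv k \<otimes> k \<otimes> j)"
      using k that by (simp only: inv_mult_group m_assoc inv_closed m_closed)
    then show ?thesis
      using k that by simp
  qed
  ultimately show ?thesis
    using k by (simp add: digraph_isos_def assoc_digraph_def)
qed

lemma auto_graph_subset:
  assumes \<xi>: "\<xi> \<in> auto G" and A: "graph_subset G A"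
  shows "graph_subset G (\<xi> ` A)"
proof -
  interpret \<xi>: group_hom G G \<xi>
    using autoD(3)[OF \<xi>] by unfold_locales
  have inj: "inj_on \<xi> (carrier G)"
    using autoD(2)[OF \<xi>] by (rule bij_betw_imp_inj_on)
  have sub: "A \<subseteq> carrier G" and dis: "A \<inter> m_inv G ` A = {}" and ne: "A \<noteq> {}"
    using A by (auto simp: graph_subset_def)
  have False if a: "a \<in> A" and b: "b \<in> A" and eq: "\<xi> a = inv (\<xi> b)" for a b
  proof -
    have "\<xi> a = \<xi> (inv b)"
      using sub b eq by auto
    then have "a = inv b"
      using inj sub a b by (auto dest: inj_onD)
    then show False
      using a b dis by blast
  qed
  then show ?thesis
    using sub ne by (auto simp: graph_subset_def)
qed

lemma auto_iso:
  assumes \<xi>: "\<xi> \<in> auto G" and A: "A \<subseteq> carrier G"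
  shows "\<xi> \<in> digraph_isos (carrier G) (assoc_digraph G A) (carrier G) (assoc_digraph G (\<xi> ` A))"
proof -
  interpret \<xi>: group_hom G G \<xi>
    using autoD(3)[OF \<xi>] by unfold_locales
  have inj: "inj_on \<xi> (carrier G)"
    using autoD(2)[OF \<xi>] by (rule bij_betw_imp_inj_on)
  have "inv (\<xi> i) \<otimes> \<xi> j \<in> \<xi> ` A \<longleftrightarrow> inv i \<otimes> j \<in> A" if "i \<in> carrier G" "j \<in> carrier G" for i j
  proof -
    have "inv (\<xi> i) \<otimes> \<xi> j = \<xi> (inv i \<otimes> j)"
      using that by simp
    then show ?thesis
      using inj_on_image_mem_iff[OF inj _ A, of "inv i \<otimes> j"] that by simp
  qed
  then show ?thesis
    using autoD(1,2)[OF \<xi>] by (simp add: digraph_isos_def assoc_digraph_def)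
qed

text \<open>All left translations are automorphisms, so commutativity makes every automorphism
  commute with them. A map commuting with all left translations is a right translation, and in a
  commutative group this is a left translation.\<close>

lemma Aut_eq_left_translations_if_comm:
  assumes "comm_group (digraph_Aut (carrier G) (assoc_digraph G A))"
  shows "comm_group G"
    and "carrier (digraph_Aut (carrier G) (assoc_digraph G A)) = left_translations G"
proof -
  let ?Aut = "digraph_isos (carrier G) (assoc_digraph G A) (carrier G) (assoc_digraph G A)"
  let ?l = "\<lambda>k. \<lambda>i\<in>carrier G. k \<otimes> i"
  have swap: "compose (carrier G) f g = compose (carrier G) g f" if "f \<in> ?Aut" "g \<in> ?Aut" for f g
    using comm_groupE(4)[OF assms, of f g] that by (simp add: mult_digraph_Aut)
  \<comment> \<open>Evaluating the commutation of \<open>f\<close> with translation by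
    \<open>g\<close> at the identity shows that \<open>f\<close> is right translation by
    \<open>f \<one>\<close>.\<close>
  have val: "f g = g \<otimes> f \<one>" if f: "f \<in> ?Aut" and g: "g \<in> carrier G" for f g
    using fun_cong[OF swap[OF f left_translation_iso[OF g]], of \<one>] digraph_isos_mem[OF f] g
    by (simp add: compose_eq)
  \<comment> \<open>Here \<open>val\<close> is applied with left translation by \<open>x\<close> as
    the automorphism.\<close>
  have comm: "x \<otimes> y = y \<otimes> x" if x: "x \<in> carrier G" and y: "y \<in> carrier G" for x y
    using val[OF left_translation_iso[OF x] y] x y by simp
  show "comm_group G"
    by (rule group_comm_groupI) (rule comm)
  have "f \<in> left_translations G" if f: "f \<in> ?Aut" for f
  proof -
    have one: "f \<one> \<in> carrier G"
      using digraph_isos_mem[OF f] by simp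
    have "f = ?l (f \<one>)"
    proof (rule extensionalityI[of _ "carrier G"])
      show "f x = ?l (f \<one>) x" if x: "x \<in> carrier G" for x
        using val[OF f x] comm[OF x one] x by (simp only: restrict_apply')
    qed (use digraph_isosD(1)[OF f] in simp_all)
    with one show ?thesis
      unfolding left_translations_def by (intro image_eqI[of f ?l "f \<one>"])
  qed
  then show "carrier (digraph_Aut (carrier G) (assoc_digraph G A)) = left_translations G"
    using left_translation_iso by (auto simp: left_translations_def)
qed

lemma comm_Aut_if_left_translations:
  assumes "comm_group G"
    and Aut: "carrier (digraph_Aut (carrier G) (assoc_digraph G A)) = left_translations G"
  shows "comm_group (digraph_Aut (carrier G) (assoc_digraph G A))"
proof (rule group.group_comm_groupI[OF group_digraph_Aut])
  interpret comm_group G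
    by (rule assms(1))
  fix f g
  assume fg: "f \<in> carrier (digraph_Aut (carrier G) (assoc_digraph G A))"
    "g \<in> carrier (digraph_Aut (carrier G) (assoc_digraph G A))"
  then obtain k l where "k \<in> carrier G" "l \<in> carrier G"
    "f = (\<lambda>i\<in>carrier G. k \<otimes> i)" "g = (\<lambda>i\<in>carrier G. l \<otimes> i)"
    unfolding Aut left_translations_def by blast
  then have "compose (carrier G) f g = compose (carrier G) g f"
    by (auto simp: compose_def m_lcomm)
  with fg show "f \<otimes>\<^bsub>digraph_Aut (carrier G) (assoc_digraph G A)\<^esub> g
      = g \<otimes>\<^bsub>digraph_Aut (carrier G) (assoc_digraph G A)\<^esub> f"
    by (simp add: mult_digraph_Aut)
qed

end

section \<open>Graph subsets whose only digraph automorphisms are the left translations\<close>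

locale rigid_graph_subset = group G for G (structure) and A +
  assumes graph_subset: "graph_subset G A"
    and Aut_eq: "carrier (digraph_Aut (carrier G) (assoc_digraph G A)) = left_translations G"
begin

lemma A_subset: "A \<subseteq> carrier G"
  using graph_subset by (simp add: graph_subset_def)

lemma iso_eqI:
  assumes f: "f \<in> digraph_isos (carrier G) (assoc_digraph G A) J Q"
    and g: "g \<in> digraph_isos (carrier G) (assoc_digraph G A) J Q"
    and one: "f \<one> = g \<one>"
  shows "f = g"
proof -
  let ?h = "compose (carrier G) (\<lambda>j\<in>J. inv_into (carrier G) g j) f"
  have h: "?h x = inv_into (carrier G) g (f x)" if "x \<in> carrier G" for x
    using that digraph_isos_mem[OF f that] by (simp add: compose_eq)
  have "?h \<in> left_translations G"
    using digraph_isos_compose[OF f digraph_isos_inv_into[OF g]] Aut_eq by simp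
  then obtain k where k: "k \<in> carrier G" "?h = (\<lambda>i\<in>carrier G. k \<otimes> i)"
    by (auto simp: left_translations_def)
  have "?h \<one> = \<one>"
    using h[of \<one>] one digraph_isosD(2)[OF g] by (simp add: bij_betw_inv_into_left)
  then have "k = \<one>"
    using k by simp
  have "f x = g x" if x: "x \<in> carrier G" for x
  proof -
    have "inv_into (carrier G) g (f x) = x"
      using h[OF x] k \<open>k = \<one>\<close> x by simp
    then show ?thesis
      using bij_betw_inv_into_right[OF digraph_isosD(2)[OF g] digraph_isos_mem[OF f x]] by simp
  qed
  with digraph_isosD(1)[OF f] digraph_isosD(1)[OF g] show ?thesis
    by (rule extensionalityI)
qed

lemma iso_fixing_one_in_auto:
  assumes f: "f \<in> digraph_isos (carrier G) (assoc_digraph G A) (carrier G) (assoc_digraph G B)"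
    and one: "f \<one> = \<one>"
  shows "f \<in> auto G"
proof -
  have "f (k \<otimes> i) = f k \<otimes> f i" if k: "k \<in> carrier G" and i: "i \<in> carrier G" for k i
  proof -
    have fk: "f k \<in> carrier G"
      using digraph_isos_mem[OF f k] .
    let ?l = "\<lambda>k. \<lambda>i\<in>carrier G. k \<otimes> i"
    \<comment> \<open>Translation by \<open>k\<close> preserves \<Gamma>[A] and translation by
      \<open>inv (f k)\<close> preserves \<Gamma>[B], so \<open>?f'\<close> is again an isomorphism;
      the second translation is chosen to make it fix the identity. The equation
      \<open>?f' = f\<close> is then the homomorphism law.\<close>
    let ?f' = "compose (carrier G) (?l (inv (f k))) (compose (carrier G) f (?l k))"
    have val: "?f' x = inv (f k) \<otimes> f (k \<otimes> x)" if "x \<in> carrier G" for x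
      using that k digraph_isos_mem[OF f] by (simp add: compose_eq)
    have "?f' \<in> digraph_isos (carrier G) (assoc_digraph G A) (carrier G) (assoc_digraph G B)"
      using fk by (intro digraph_isos_compose[OF _ left_translation_iso]
          digraph_isos_compose[OF left_translation_iso f] k) auto
    moreover have "?f' \<one> = f \<one>"
      using val[of \<one>] k fk one by simp
    ultimately have "?f' = f"
      using iso_eqI[OF _ f] by blast
    then have "f i = inv (f k) \<otimes> f (k \<otimes> i)"
      using val[OF i] by simp
    moreover have "f (k \<otimes> i) \<in> carrier G"
      using digraph_isos_mem[OF f] k i by simp
    moreover have "f i \<in> carrier G"
      using digraph_isos_mem[OF f i] .
    ultimately show ?thesis
      using inv_solve_left[of "f i" "f k" "f (k \<otimes> i)"] fk by simp
  qed
  then show ?thesis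
    using digraph_isosD(1,2)[OF f] digraph_isos_mem[OF f]
    by (auto simp: auto_def hom_def Bij_def)
qed

lemma auto_one: "\<xi> \<in> auto G \<Longrightarrow> \<xi> \<one> = \<one>"
  by (rule hom_one[OF autoD(3) group_axioms group_axioms])

text \<open>Both maps are isomorphisms from \<Gamma>[A] to the same digraph and both fix the
  identity, so rigidity applies. This yields uniqueness of the automorphism and, later, the
  count.\<close>

lemma auto_eqI:
  assumes "\<xi> \<in> auto G" "\<zeta> \<in> auto G" "\<xi> ` A = \<zeta> ` A"
  shows "\<xi> = \<zeta>"
proof (rule iso_eqI)
  show "\<xi> \<in> digraph_isos (carrier G) (assoc_digraph G A) (carrier G) (assoc_digraph G (\<xi> ` A))"
    using assms(1) A_subset by (rule auto_iso)
  show "\<zeta> \<in> digraph_isos (carrier G) (assoc_digraph G A) (carrier G) (assoc_digraph G (\<xi> ` A))"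
    unfolding assms(3) using assms(2) A_subset by (rule auto_iso)
  show "\<xi> \<one> = \<zeta> \<one>"
    by (simp only: auto_one[OF assms(1)] auto_one[OF assms(2)])
qed

lemma ex_auto:
  assumes B: "graph_subset G B"
    and iso: "digraph_isomorphic (carrier G) (assoc_digraph G B) (carrier G) (assoc_digraph G A)"
  obtains \<xi> where "\<xi> \<in> auto G" "B = \<xi> ` A"
proof -
  obtain f where f: "f \<in> digraph_isos (carrier G) (assoc_digraph G A) (carrier G) (assoc_digraph G B)"
    using digraph_isomorphic_sym[OF iso] by (auto simp: digraph_isomorphic_def)
  have f1: "f \<one> \<in> carrier G"
    using digraph_isos_mem[OF f] by simp
  \<comment> \<open>Following \<open>f\<close> by a translation of \<Gamma>[B] normalises it to fix
    the identity.\<close>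
  define \<xi> where "\<xi> = compose (carrier G) (\<lambda>i\<in>carrier G. inv (f \<one>) \<otimes> i) f"
  have \<xi>: "\<xi> \<in> digraph_isos (carrier G) (assoc_digraph G A) (carrier G) (assoc_digraph G B)"
    unfolding \<xi>_def using f1 by (intro digraph_isos_compose[OF f left_translation_iso]) auto
  have one: "\<xi> \<one> = \<one>"
    using f1 by (simp add: \<xi>_def compose_eq)
  have sub: "B \<subseteq> carrier G"
    using B by (simp add: graph_subset_def)
  \<comment> \<open>\<open>A\<close> and \<open>B\<close> are the sets of out-neighbours of the
    identity in \<Gamma>[A] and \<Gamma>[B], so an isomorphism fixing the identity carries one onto
    the other.\<close>
  have mem: "\<xi> x \<in> B \<longleftrightarrow> x \<in> A" if x: "x \<in> carrier G" for x
    using digraph_isosD(3)[OF \<xi> one_closed x] one x digraph_isos_mem[OF \<xi> x]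
    by (simp add: mem_assoc_digraph_one sub A_subset)
  have "B = \<xi> ` A"
  proof (intro equalityI subsetI)
    fix b
    assume b: "b \<in> B"
    with sub bij_betw_imp_surj_on[OF digraph_isosD(2)[OF \<xi>]]
    obtain x where x: "x \<in> carrier G" "b = \<xi> x"
      by (metis imageE subsetD)
    with b mem show "b \<in> \<xi> ` A"
      by simp
  next
    fix b
    assume "b \<in> \<xi> ` A"
    then obtain x where "x \<in> A" "b = \<xi> x"
      by (rule imageE)
    with mem[of x] A_subset show "b \<in> B"
      by (simp add: subsetD)
  qed
  with iso_fixing_one_in_auto[OF \<xi> one] show thesis
    by (rule that)
qed

lemma isos_fixing_one:
  assumes "\<xi> \<in> auto G"
  shows "\<rho> \<in> digraph_isos (carrier G) (assoc_digraph G A) (carrier G) (assoc_digraph G (\<xi> ` A))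
      \<and> \<rho> \<one> = \<one> \<longleftrightarrow> \<rho> = \<xi>"
proof
  assume "\<rho> \<in> digraph_isos (carrier G) (assoc_digraph G A) (carrier G) (assoc_digraph G (\<xi> ` A))
    \<and> \<rho> \<one> = \<one>"
  then show "\<rho> = \<xi>"
    by (intro iso_eqI[OF _ auto_iso[OF assms A_subset]]) (simp_all add: auto_one[OF assms])
next
  assume "\<rho> = \<xi>"
  then show "\<rho> \<in> digraph_isos (carrier G) (assoc_digraph G A) (carrier G) (assoc_digraph G (\<xi> ` A))
    \<and> \<rho> \<one> = \<one>"
    using auto_iso[OF assms A_subset] auto_one[OF assms] by (simp only: simp_thms)
qed

lemma isomorphic_graph_subsets:
  "{\<xi> ` A | \<xi>. \<xi> \<in> auto G} =
    {B. graph_subset G B \<and>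
        digraph_isomorphic (carrier G) (assoc_digraph G B) (carrier G) (assoc_digraph G A)}"
  (is "?L = ?R")
proof
  have "\<xi> ` A \<in> ?R" if \<xi>: "\<xi> \<in> auto G" for \<xi>
    using auto_graph_subset[OF \<xi> graph_subset] digraph_isos_inv_into[OF auto_iso[OF \<xi> A_subset]]
    by (auto simp only: digraph_isomorphic_def mem_Collect_eq)
  then show "?L \<subseteq> ?R"
    by blast
  show "?R \<subseteq> ?L"
  proof
    fix B
    assume "B \<in> ?R"
    then obtain \<xi> where "\<xi> \<in> auto G" "B = \<xi> ` A"
      using ex_auto[of B] by auto
    then show "B \<in> ?L"
      by blast
  qed
qed

text \<open>The graph subsets in question form the orbit of \<open>A\<close> under
  \<open>auto G\<close>, and by \<open>auto_eqI\<close> distinct automorphisms give distinct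
  images.\<close>

lemma card_isomorphic_graph_subsets:
  "card {B. graph_subset G B \<and>
      digraph_isomorphic (carrier G) (assoc_digraph G B) (carrier G) (assoc_digraph G A)}
    = card (auto G)"
proof -
  have "{\<xi> ` A | \<xi>. \<xi> \<in> auto G} = (\<lambda>\<xi>. \<xi> ` A) ` auto G"
    by blast
  moreover have "inj_on (\<lambda>\<xi>. \<xi> ` A) (auto G)"
    by (rule inj_onI) (rule auto_eqI)
  ultimately show ?thesis
    using isomorphic_graph_subsets by (simp add: card_image)
qed

end

section \<open>Automorphisms of residue rings\<close>

context residues
begin

text \<open>An additive endomorphism of the residue ring is multiplication by its value at 1, since
  1 generates the additive group; it is bijective exactly when that value is a unit.\<close>

lemma bij_betw_Units_auto:
  "bij_betw (\<lambda>a. \<lambda>i\<in>carrier R. a \<otimes> i) (Units R) (auto (add_monoid R))"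
proof (rule bij_betw_imageI)
  let ?m = "\<lambda>a. \<lambda>i\<in>carrier R. a \<otimes> i"
  show "inj_on ?m (Units R)"
  proof (rule inj_onI)
    fix a b
    assume "a \<in> Units R" "b \<in> Units R" "?m a = ?m b"
    from fun_cong[OF this(3), of \<one>] this(1,2)[THEN Units_closed] show "a = b"
      by simp
  qed
  have "?m a \<in> auto (add_monoid R)" if a: "a \<in> Units R" for a
  proof -
    have "bij_betw (\<lambda>i. a \<otimes> i) (carrier R) (carrier R)"
      by (rule bij_betw_byWitness[where f' = "\<lambda>i. inv a \<otimes> i"])
        (use a Units_closed[OF a] in
          \<open>auto simp: m_assoc[symmetric] Units_l_inv Units_r_inv simp del: Units_l_cancel\<close>)
    moreover have "?m a \<in> hom (add_monoid R) (add_monoid R)"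
      using Units_closed[OF a] by (intro homI) (simp_all add: r_distr)
    ultimately show ?thesis
      by (simp add: auto_def Bij_def)
  qed
  moreover have "\<xi> \<in> ?m ` Units R" if \<xi>: "\<xi> \<in> auto (add_monoid R)" for \<xi>
  proof (rule image_eqI)
    have closed: "\<xi> x \<in> carrier R" if "x \<in> carrier R" for x
      using autoD(2)[OF \<xi>] that by (auto dest: bij_betw_apply)
    have add: "\<xi> (x \<oplus> y) = \<xi> x \<oplus> \<xi> y" if "x \<in> carrier R" "y \<in> carrier R" for x y
      using autoD(3)[OF \<xi>] that by (auto simp: hom_def)
    have zero: "\<xi> \<zero> = \<zero>"
      using add[of \<zero> \<zero>] closed[of \<zero>] by simp
    \<comment> \<open>The induction runs over natural numbers reduced mod \<open>m\<close>: passing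
      from \<open>k\<close> to \<open>Suc k\<close> adds the ring element 1, also when the residue
      wraps around to 0.\<close>
    have nat: "\<xi> (int k mod m) = \<xi> \<one> \<otimes> (int k mod m)" for k :: nat
    proof (induction k)
      case 0
      have "int 0 mod m = \<zero>"
        by (simp add: res_zero_eq)
      then show ?case
        using zero closed[OF one_closed] by (simp only: r_null)
    next
      case (Suc k)
      have eq: "int (Suc k) mod m = \<one> \<oplus> (int k mod m)"
        unfolding one_cong add_cong by simp
      show ?case
        unfolding eq using Suc add closed by (simp add: r_distr)
    qed
    \<comment> \<open>The carrier consists of the integers from 0 to m - 1, so \<open>x\<close> is
      its own residue.\<close>
    have val: "\<xi> x = \<xi> \<one> \<otimes> x" if "x \<in> carrier R" for x
      using nat[of "nat x"] that by (simp add: res_carrier_eq)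
    show "\<xi> = ?m (\<xi> \<one>)"
    proof (rule extensionalityI[of _ "carrier R"])
      show "\<xi> x = ?m (\<xi> \<one>) x" if "x \<in> carrier R" for x
        using val[OF that] that by (simp only: restrict_apply')
    qed (use autoD(1)[OF \<xi>] in simp_all)
    \<comment> \<open>By surjectivity some \<open>x\<close> is mapped to 1, and this
      \<open>x\<close> is a multiplicative inverse of \<open>\<xi> \<one>\<close>.\<close>
    have "\<xi> ` carrier R = carrier R"
      using bij_betw_imp_surj_on[OF autoD(2)[OF \<xi>]] by simp
    then obtain x where "x \<in> carrier R" "\<xi> x = \<one>"
      using one_closed by (metis imageE)
    then have "\<xi> \<one> \<otimes> x = \<one>"
      by (simp only: val[symmetric])
    with \<open>x \<in> carrier R\<close> show "\<xi> \<one> \<in> Units R"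
      using closed[OF one_closed] m_comm unfolding Units_def by auto
  qed
  ultimately show "?m ` Units R = auto (add_monoid R)"
    by blast
qed

text \<open>The general description by \<open>auto Z\<close> is transported along
  \<open>bij_betw_Units_auto\<close>, which replaces automorphisms by units, counted by the
  totient.\<close>

lemma graph_subsets_isomorphic_to_rigid:
  fixes A
  defines "Z \<equiv> add_monoid R"
  assumes A: "graph_subset Z A"
    and Aut: "carrier (digraph_Aut (carrier Z) (assoc_digraph Z A)) = left_translations Z"
  shows "{(\<lambda>i. a \<otimes> i) ` A | a. a \<in> Units R} =
      {B. graph_subset Z B \<and>
        digraph_isomorphic (carrier Z) (assoc_digraph Z B) (carrier Z) (assoc_digraph Z A)}"
    and "card {B. graph_subset Z B \<and>
        digraph_isomorphic (carrier Z) (assoc_digraph Z B) (carrier Z) (assoc_digraph Z A)}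
      = totient (nat m)"
proof -
  have "group Z"
    unfolding Z_def by (rule add.is_group)
  then interpret Z: rigid_graph_subset Z A
    using A Aut by (intro rigid_graph_subset.intro rigid_graph_subset_axioms.intro)
  have bij: "bij_betw (\<lambda>a. \<lambda>i\<in>carrier R. a \<otimes> i) (Units R) (auto Z)"
    unfolding Z_def by (rule bij_betw_Units_auto)
  have "A \<subseteq> carrier R"
    using Z.A_subset by (simp add: Z_def)
  \<comment> \<open>Automorphisms are extensional while the statement uses plain multiplication; on
    subsets of the carrier the two have the same image.\<close>
  then have image: "(\<lambda>i\<in>carrier R. a \<otimes> i) ` A = (\<lambda>i. a \<otimes> i) ` A" for a
    by (intro image_cong) (simp_all add: subsetD)
  have "{(\<lambda>i. a \<otimes> i) ` A | a. a \<in> Units R} = (\<lambda>\<xi>. \<xi> ` A) ` auto Z"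
    unfolding bij_betw_imp_surj_on[OF bij, symmetric] image_image image by (rule Setcompr_eq_image)
  also have "\<dots> = {\<xi> ` A | \<xi>. \<xi> \<in> auto Z}"
    by (rule Setcompr_eq_image[symmetric])
  finally show "{(\<lambda>i. a \<otimes> i) ` A | a. a \<in> Units R} =
      {B. graph_subset Z B \<and>
        digraph_isomorphic (carrier Z) (assoc_digraph Z B) (carrier Z) (assoc_digraph Z A)}"
    unfolding Z.isomorphic_graph_subsets .
  show "card {B. graph_subset Z B \<and>
        digraph_isomorphic (carrier Z) (assoc_digraph Z B) (carrier Z) (assoc_digraph Z A)}
      = totient (nat m)"
    unfolding Z.card_isomorphic_graph_subsets totient_eq
    using bij_betw_same_card[OF bij] by (rule sym)
qed

end

theorem theorem3p8:
  fixes G :: "('a, 'b) monoid_scheme"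
  shows
    "(\<forall>A. group G \<and> finite (carrier G) \<and> odd (order G) \<and> graph_subset G A \<longrightarrow>
        (\<forall>\<xi>\<in>auto G. graph_subset G (\<xi> ` A) \<and>
            \<xi> \<in> digraph_isos (carrier G) (assoc_digraph G A)
                  (carrier G) (assoc_digraph G (\<xi> ` A))) \<and>
        (comm_group (digraph_Aut (carrier G) (assoc_digraph G A)) \<longleftrightarrow>
            comm_group G \<and>
            carrier (digraph_Aut (carrier G) (assoc_digraph G A)) = left_translations G) \<and>
        (carrier (digraph_Aut (carrier G) (assoc_digraph G A)) = left_translations G \<longrightarrow>
            (\<forall>B. graph_subset G B \<and>
                  digraph_isomorphic (carrier G) (assoc_digraph G B)
                    (carrier G) (assoc_digraph G A) \<longrightarrow>
                (\<exists>!\<xi>. \<xi> \<in> auto G \<and> B = \<xi> ` A) \<and>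
                (\<forall>\<xi>. \<xi> \<in> auto G \<and> B = \<xi> ` A \<longrightarrow>
                   (\<forall>\<rho>. \<rho> \<in> digraph_isos (carrier G) (assoc_digraph G A)
                               (carrier G) (assoc_digraph G B) \<and> \<rho> \<one>\<^bsub>G\<^esub> = \<one>\<^bsub>G\<^esub> \<longleftrightarrow> \<rho> = \<xi>))) \<and>
            {\<xi> ` A | \<xi>. \<xi> \<in> auto G} =
              {B. graph_subset G B \<and>
                  digraph_isomorphic (carrier G) (assoc_digraph G B)
                    (carrier G) (assoc_digraph G A)} \<and>
            card {B. graph_subset G B \<and>
                  digraph_isomorphic (carrier G) (assoc_digraph G B)
                    (carrier G) (assoc_digraph G A)} = order (AutoGroup G)))
     \<and>
     (\<forall>(n::nat) A. let R = residue_ring (int (2 * n + 1)); Z = add_monoid R in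
        graph_subset Z A \<and>
        carrier (digraph_Aut (carrier Z) (assoc_digraph Z A)) = left_translations Z \<longrightarrow>
          {(\<lambda>i. a \<otimes>\<^bsub>R\<^esub> i) ` A | a. a \<in> Units R} =
            {B. graph_subset Z B \<and>
                digraph_isomorphic (carrier Z) (assoc_digraph Z B)
                  (carrier Z) (assoc_digraph Z A)} \<and>
          card {B. graph_subset Z B \<and>
                digraph_isomorphic (carrier Z) (assoc_digraph Z B)
                  (carrier Z) (assoc_digraph Z A)} = totient (2 * n + 1))"
proof (intro conjI allI impI)
  fix A
  assume "group G \<and> finite (carrier G) \<and> odd (order G) \<and> graph_subset G A"
  then interpret group G
    by simp
  have A: "graph_subset G A" "A \<subseteq> carrier G"
    using \<open>group G \<and> finite (carrier G) \<and> odd (order G) \<and> graph_subset G A\<close>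
    by (auto simp: graph_subset_def)
  let ?Aut = "digraph_Aut (carrier G) (assoc_digraph G A)"
  show "\<forall>\<xi>\<in>auto G. graph_subset G (\<xi> ` A) \<and>
      \<xi> \<in> digraph_isos (carrier G) (assoc_digraph G A) (carrier G) (assoc_digraph G (\<xi> ` A))"
    using auto_graph_subset auto_iso A by blast
  show "comm_group ?Aut \<longleftrightarrow> comm_group G \<and> carrier ?Aut = left_translations G"
    using Aut_eq_left_translations_if_comm comm_Aut_if_left_translations by blast
  assume Aut: "carrier ?Aut = left_translations G"
  interpret rigid_graph_subset G A
    using A Aut by unfold_locales
  show "card {B. graph_subset G B \<and>
      digraph_isomorphic (carrier G) (assoc_digraph G B) (carrier G) (assoc_digraph G A)}
      = order (AutoGroup G)"
    by (simp add: card_isomorphic_graph_subsets order_def AutoGroup_def)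
  show "{\<xi> ` A | \<xi>. \<xi> \<in> auto G} = {B. graph_subset G B \<and>
      digraph_isomorphic (carrier G) (assoc_digraph G B) (carrier G) (assoc_digraph G A)}"
    by (rule isomorphic_graph_subsets)
  fix B
  assume "graph_subset G B \<and>
      digraph_isomorphic (carrier G) (assoc_digraph G B) (carrier G) (assoc_digraph G A)"
  then show "\<exists>!\<xi>. \<xi> \<in> auto G \<and> B = \<xi> ` A"
    using ex_auto auto_eqI by metis
  fix \<xi> \<rho>
  assume "\<xi> \<in> auto G \<and> B = \<xi> ` A"
  then show "\<rho> \<in> digraph_isos (carrier G) (assoc_digraph G A) (carrier G) (assoc_digraph G B)
      \<and> \<rho> \<one>\<^bsub>G\<^esub> = \<one>\<^bsub>G\<^esub> \<longleftrightarrow> \<rho> = \<xi>"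
    by (simp only: isos_fixing_one)
next
  fix n :: nat and A
  show "let R = residue_ring (int (2 * n + 1)); Z = add_monoid R in
        graph_subset Z A \<and>
        carrier (digraph_Aut (carrier Z) (assoc_digraph Z A)) = left_translations Z \<longrightarrow>
          {(\<lambda>i. a \<otimes>\<^bsub>R\<^esub> i) ` A | a. a \<in> Units R} =
            {B. graph_subset Z B \<and>
                digraph_isomorphic (carrier Z) (assoc_digraph Z B)
                  (carrier Z) (assoc_digraph Z A)} \<and>
          card {B. graph_subset Z B \<and>
                digraph_isomorphic (carrier Z) (assoc_digraph Z B)
                  (carrier Z) (assoc_digraph Z A)} = totient (2 * n + 1)"
  \<comment> \<open>The locale \<open>residues\<close> requires a modulus above 1, so modulus 1 is
    treated apart: in the trivial group the only nonempty subset equals its own inverse set, hence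
    there is no graph subset.\<close>
  proof (cases "n = 0")
    case True
    define Z where "Z = add_monoid (residue_ring 1)"
    have Z: "carrier Z = {0}" "inv\<^bsub>Z\<^esub> 0 = 0"
      by (auto simp: Z_def residue_ring_def m_inv_def)
    have "\<not> graph_subset Z A"
    proof
      assume "graph_subset Z A"
      then have "A = {0}" "A \<inter> m_inv Z ` A = {}"
        using Z(1) by (auto simp: graph_subset_def)
      with Z(2) show False
        by simp
    qed
    with True show ?thesis
      by (simp add: Z_def)
  next
    case False
    then have residues: "residues (int (2 * n + 1))"
      by unfold_locales simp
    show ?thesis
      using residues.graph_subsets_isomorphic_to_rigid[OF residues, of A]
      unfolding Let_def nat_int by blast
  qed
qed

end
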